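(* Under the canonical permutation-equivariant coupling $$M = \alpha I_C + \beta\,\mathbf{1}\mathbf{1}^\top,$$ the full state update matrix decomposes into two invariant subspaces: (1) the zero-sum subspace (orthogonal to $\mathbf{1}$), and (2) the span of $\mathbf{1}$. The eigenvalues along these subspaces are, respectively, $$\lambda_{\mathrm{diff}} = \alpha, \qquad \lambda_{\mathrm{mean}} = \alpha + C\beta.$$ Hence stability requires $$|\alpha| < 1, \qquad |\alpha + C\beta| < 1.$$ Thus, permutation symmetry reduces the stability analysis to two scalar constraints corresponding to the mean and difference modes.
   Context: $C$ is the number of variables, $\alpha,\beta\in\mathbb{R}$ are scalars, $I_C$ is the $C\times C$ identity matrix, and $\mathbf{1}\in\mathbb{R}^C$ is the column vector of all ones. $M\in\mathbb{R}^{C\times C}$ is the matrix coupling the states of the $C$ variables in a discrete-time linear state update $h_v(t+1,c)=\sum_{j=1}^C M_{c,j}h_v(t,j)$, where $h_v(t,c)$ is the state of variable $c$ at time $t$ (input term omitted); the form $\alpha I_C+\beta\mathbf{1}\mathbf{1}^\top$ is the form of a matrix commuting with all $C\times C$ permutation matrices. Stability refers to stability of this discrete-time state update. The difference mode is the dynamics on the zero-sum subspace, the mean mode the dynamics on the span of $\mathbf{1}$.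
   Formalization: The claims that α is an eigenvalue on the zero-sum subspace and that stability requires |α| < 1 are stated for C ≥ 2; for C = 1 that subspace is {0} and they fail (α = 2, β = −2 gives M = 0, which is stable). *)

theory Defs
  imports "HOL-Analysis.Analysis"
begin

definition ones :: "real ^ 'n" where
  "ones = (\<chi> i. 1)"

definition canonical_coupling :: "real \<Rightarrow> real \<Rightarrow> real ^ 'n ^ 'n" where
  "canonical_coupling \<alpha> \<beta> =
     \<alpha> *\<^sub>R mat 1 + \<beta> *\<^sub>R ((columnvector ones :: real ^ 1 ^ 'n) ** (rowvector ones :: real ^ 'n ^ 1))"

definition permutation_matrix :: "('n \<Rightarrow> 'n) \<Rightarrow> real ^ 'n ^ 'n" where
  "permutation_matrix p = (\<chi> i j. if j = p i then 1 else 0)"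

definition permutation_equivariant :: "real ^ 'n ^ 'n \<Rightarrow> bool" where
  "permutation_equivariant M \<longleftrightarrow>
     (\<forall>p. p permutes (UNIV :: 'n set) \<longrightarrow> permutation_matrix p ** M = M ** permutation_matrix p)"

definition zero_sum_subspace :: "(real ^ 'n) set" where
  "zero_sum_subspace = {x. (\<Sum>i\<in>UNIV. x $ i) = 0}"

definition mean_subspace :: "(real ^ 'n) set" where
  "mean_subspace = span {ones}"

definition invariant_subspace :: "real ^ 'n ^ 'n \<Rightarrow> (real ^ 'n) set \<Rightarrow> bool" where
  "invariant_subspace M V \<longleftrightarrow> subspace V \<and> (\<forall>v\<in>V. M *v v \<in> V)"

definition eigenvalues_on :: "real ^ 'n ^ 'n \<Rightarrow> (real ^ 'n) set \<Rightarrow> real set" where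
  "eigenvalues_on M V = {\<mu>. \<exists>v\<in>V. v \<noteq> 0 \<and> M *v v = \<mu> *\<^sub>R v}"

definition trajectory_in :: "real ^ 'n ^ 'n \<Rightarrow> (real ^ 'n) set \<Rightarrow> (nat \<Rightarrow> real ^ 'n) \<Rightarrow> bool" where
  "trajectory_in M V h \<longleftrightarrow>
     (\<forall>t. h t \<in> V) \<and> (\<forall>t c. h (Suc t) $ c = (\<Sum>j\<in>UNIV. M $ c $ j * h t $ j))"

(* Asymptotic stability of the equilibrium 0: Lyapunov stability together with local attractivity. *)
definition asymptotically_stable_on :: "real ^ 'n ^ 'n \<Rightarrow> (real ^ 'n) set \<Rightarrow> bool" where
  "asymptotically_stable_on M V \<longleftrightarrow>
     (\<forall>\<epsilon>>0. \<exists>\<delta>>0. \<forall>h. trajectory_in M V h \<longrightarrow> norm (h 0) < \<delta> \<longrightarrow> (\<forall>t. norm (h t) < \<epsilon>)) \<and>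
     (\<exists>\<delta>>0. \<forall>h. trajectory_in M V h \<longrightarrow> norm (h 0) < \<delta> \<longrightarrow> h \<longlonglongrightarrow> 0)"

abbreviation asymptotically_stable :: "real ^ 'n ^ 'n \<Rightarrow> bool" where
  "asymptotically_stable M \<equiv> asymptotically_stable_on M UNIV"

lemma canonical_coupling_nth:
  "canonical_coupling \<alpha> \<beta> $ i $ j = (if i = j then \<alpha> else 0) + \<beta>"
  by (simp add: canonical_coupling_def ones_def mat_def matrix_matrix_mult_def
      columnvector_def rowvector_def)

lemma permutation_equivariant_nth:
  fixes M :: "real ^ 'n ^ 'n"
  shows "permutation_equivariant M \<longleftrightarrow> (\<forall>p. p permutes UNIV \<longrightarrow> (\<forall>i j. M $ p i $ p j = M $ i $ j))"
proof -
  have "permutation_matrix p ** M = M ** permutation_matrix p \<longleftrightarrow> (\<forall>i j. M $ p i $ p j = M $ i $ j)"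
    if p: "p permutes UNIV" for p :: "'n \<Rightarrow> 'n"
  proof -
    have L: "(permutation_matrix p ** M) $ i $ j = M $ p i $ j" for i j
      by (simp add: permutation_matrix_def matrix_matrix_mult_def if_distrib[of "\<lambda>x. x * _"] cong: if_cong)
    have R: "(M ** permutation_matrix p) $ i $ p j = M $ i $ j" for i j
      using permutes_inj[OF p]
      by (simp add: permutation_matrix_def matrix_matrix_mult_def inj_eq if_distrib[of "\<lambda>x. _ * x"] cong: if_cong)
    have "permutation_matrix p ** M = M ** permutation_matrix p \<longleftrightarrow>
        (\<forall>i j. (permutation_matrix p ** M) $ i $ j = (M ** permutation_matrix p) $ i $ j)"
      by (simp add: vec_eq_iff)
    also have "\<dots> \<longleftrightarrow> (\<forall>i j. (permutation_matrix p ** M) $ i $ p j = (M ** permutation_matrix p) $ i $ p j)"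
      by (metis permutes_surj[OF p] surjD)
    finally show ?thesis by (simp add: L R)
  qed
  then show ?thesis by (auto simp: permutation_equivariant_def)
qed

lemma permutation_equivariant_iff_canonical_coupling:
  fixes M :: "real ^ 'n ^ 'n"
  shows "permutation_equivariant M \<longleftrightarrow> (\<exists>\<alpha> \<beta>. M = canonical_coupling \<alpha> \<beta>)"
proof
  assume "\<exists>\<alpha> \<beta>. M = canonical_coupling \<alpha> \<beta>"
  then show "permutation_equivariant M"
    by (auto simp: permutation_equivariant_nth canonical_coupling_nth inj_eq[OF permutes_inj])
next
  assume "permutation_equivariant M"
  then have E: "M $ p i $ p j = M $ i $ j" if "p permutes UNIV" for p i j
    using that by (auto simp: permutation_equivariant_nth)
  have diag: "M $ k $ k = M $ i $ i" for i k
    using E[of "Transposition.transpose i k" i i] by (simp add: permutes_swap_id)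
  have off: "M $ k $ l = M $ i $ j" if "i \<noteq> j" "k \<noteq> l" for i j k l
  proof -
    let ?p = "Transposition.transpose (Transposition.transpose i k j) l \<circ> Transposition.transpose i k"
    have "?p permutes UNIV"
      by (intro permutes_compose permutes_swap_id) auto
    moreover have "Transposition.transpose i k j \<noteq> k"
      using that by (auto simp: transpose_eq_iff)
    ultimately show ?thesis
      using E[of ?p i j] that by (simp add: transpose_apply_other)
  qed
  obtain \<beta> where \<beta>: "\<And>i j. i \<noteq> j \<Longrightarrow> M $ i $ j = \<beta>"
    using off by metis
  have "M = canonical_coupling (M $ i $ i - \<beta>) \<beta>" for i
    using diag[of _ i] \<beta> by (simp add: vec_eq_iff canonical_coupling_nth)
  then show "\<exists>\<alpha> \<beta>. M = canonical_coupling \<alpha> \<beta>" by blast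
qed

end

theory Submission
  imports Defs
begin

text \<open>
  The coupling acts by \<open>M v = \<alpha> v + \<beta> (\<Sum>i. v i) 1\<close>, hence as a scalar on each of the two
  orthogonal subspaces. An eigenvector with eigenvalue \<open>c\<close> yields the trajectory \<open>c ^ t v\<close>, which
  tends to \<open>0\<close> only if \<open>\<bar>c\<bar> < 1\<close>. Conversely, if the two scalars have modulus below 1, then by
  Pythagoras \<open>M\<close> contracts the norm by a factor below 1.
\<close>

lemma canonical_coupling_mult_vec:
  fixes v :: "real ^ 'n"
  shows "canonical_coupling \<alpha> \<beta> *v v = \<alpha> *\<^sub>R v + (\<beta> * (\<Sum>i\<in>UNIV. v $ i)) *\<^sub>R ones"
proof -
  have "(\<Sum>j\<in>UNIV. ((if i = j then \<alpha> else 0) + \<beta>) * v $ j) = \<alpha> * v $ i + \<beta> * (\<Sum>j\<in>UNIV. v $ j)"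
    for i
    by (simp add: distrib_right sum.distrib sum_distrib_left if_distrib[of "\<lambda>x. x * _"] cong: if_cong)
  then show ?thesis
    by (simp add: vec_eq_iff matrix_vector_mult_def canonical_coupling_nth ones_def)
qed

lemma ones_nonzero: "(ones :: real ^ 'n) \<noteq> 0"
  by (simp add: ones_def vec_eq_iff)

lemma zero_sum_subspace_eq_orthogonal: "zero_sum_subspace = {x. orthogonal ones x}"
  by (simp add: zero_sum_subspace_def orthogonal_def inner_vec_def ones_def)

lemma subspace_zero_sum_subspace: "subspace zero_sum_subspace"
  unfolding zero_sum_subspace_eq_orthogonal by (rule subspace_orthogonal_to_vector)

lemma mean_subspace_eq_range: "mean_subspace = range (\<lambda>k. k *\<^sub>R ones)"
  by (simp add: mean_subspace_def span_singleton)

lemma subspace_mean_subspace: "subspace mean_subspace"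
  by (simp add: mean_subspace_def)

lemma ones_in_mean_subspace: "ones \<in> mean_subspace"
  by (simp add: mean_subspace_def span_base)

lemma zero_sum_orthogonal_mean:
  assumes "x \<in> zero_sum_subspace" "y \<in> mean_subspace"
  shows "orthogonal x y"
  using assms by (auto simp: zero_sum_subspace_eq_orthogonal mean_subspace_eq_range
      orthogonal_def inner_commute)

lemma zero_sum_plus_mean:
  "{x + y | x y. x \<in> (zero_sum_subspace :: (real ^ 'n) set) \<and> y \<in> mean_subspace} = UNIV"
proof -
  have "\<exists>x y. v = x + y \<and> x \<in> zero_sum_subspace \<and> y \<in> mean_subspace" for v :: "real ^ 'n"
  proof (intro exI conjI)
    \<comment> \<open>\<open>?m\<close> is the average of the coordinates. The entries of
      \<open>ones\<close> add up to \<open>CARD('n)\<close>, so subtracting \<open>?m\<close> from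
      each coordinate cancels the sum.\<close>
    let ?m = "(\<Sum>i\<in>UNIV. v $ i) / real CARD('n)"
    show "v = (v - ?m *\<^sub>R ones) + ?m *\<^sub>R ones" by simp
    show "v - ?m *\<^sub>R ones \<in> zero_sum_subspace"
      by (simp add: zero_sum_subspace_def ones_def sum_subtractf)
    show "?m *\<^sub>R ones \<in> mean_subspace"
      unfolding mean_subspace_eq_range by (rule rangeI)
  qed
  then show ?thesis by auto
qed

text \<open>The difference of two distinct standard basis vectors is a witness. It gives the
  difference mode an actual eigenvector, without which \<alpha> would not be an eigenvalue
  there.\<close>

lemma zero_sum_nonzero_exists:
  assumes "2 \<le> CARD('n)"
  shows "\<exists>v\<in>(zero_sum_subspace :: (real ^ 'n) set). v \<noteq> 0"
proof -
  obtain i j :: 'n where "i \<noteq> j"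
    using assms card_le_Suc0_iff_eq[of "UNIV :: 'n set"] by auto
  then have "axis i 1 - axis j 1 \<in> (zero_sum_subspace :: (real ^ 'n) set)"
    and "axis i 1 - axis j 1 \<noteq> (0 :: real ^ 'n)"
    by (auto simp: zero_sum_subspace_def axis_def sum_subtractf vec_eq_iff)
  then show ?thesis by blast
qed

text \<open>With a single variable there is no difference mode, so \<alpha> alone puts no constraint
  on stability. This is the case excluded by the guards \<open>2 \<le> CARD('n)\<close>.\<close>

lemma zero_sum_trivial:
  assumes "CARD('n) = 1" and "(x :: real ^ 'n) \<in> zero_sum_subspace"
  shows "x = 0"
proof -
  obtain a :: 'n where "UNIV = {a}" using assms(1) by (metis card_1_singletonE)
  then show ?thesis using assms(2) unfolding zero_sum_subspace_def vec_eq_iff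
    by (metis (mono_tags, lifting) UNIV_I empty_iff finite.emptyI insertE mem_Collect_eq
        sum.empty sum.insert add.right_neutral zero_index)
qed

lemma invariant_subspace_scalar:
  assumes "subspace V" "\<And>v. v \<in> V \<Longrightarrow> M *v v = c *\<^sub>R v"
  shows "invariant_subspace M V"
  using assms by (simp add: invariant_subspace_def subspace_scale)

lemma eigenvalues_on_scalar:
  assumes "\<And>v. v \<in> V \<Longrightarrow> M *v v = c *\<^sub>R v" "w \<in> V" "w \<noteq> 0"
  shows "eigenvalues_on M V = {c}"
  using assms by (fastforce simp: eigenvalues_on_def)

lemma trajectory_in_iff:
  "trajectory_in M V h \<longleftrightarrow> (\<forall>t. h t \<in> V \<and> h (Suc t) = M *v h t)"
  by (auto simp: trajectory_in_def vec_eq_iff matrix_vector_mult_def)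

text \<open>One eigenvector in \<open>V\<close> suffices, so the lemma serves both for a single mode
  and, with \<open>V = UNIV\<close>, for the whole system.\<close>

lemma asymptotically_stable_on_eigenvalue:
  fixes M :: "real ^ 'n ^ 'n"
  assumes st: "asymptotically_stable_on M V" and V: "subspace V"
    and v: "v \<in> V" "v \<noteq> 0" and ev: "M *v v = c *\<^sub>R v"
  shows "\<bar>c\<bar> < 1"
proof -
  obtain \<delta> where "\<delta> > 0"
    and \<delta>: "\<And>h. trajectory_in M V h \<Longrightarrow> norm (h 0) < \<delta> \<Longrightarrow> h \<longlonglongrightarrow> 0"
    using st unfolding asymptotically_stable_on_def by blast
  \<comment> \<open>Attractivity is only local: this scaling makes the initial norm \<delta> / 2,
    inside the ball of attraction.\<close>
  define s where "s = \<delta> / (2 * norm v)"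
  define h where "h t = (c ^ t * s) *\<^sub>R v" for t
  have s: "s > 0" using \<open>\<delta> > 0\<close> v by (simp add: s_def)
  have "trajectory_in M V h"
    using V v ev by (simp add: trajectory_in_iff h_def subspace_scale matrix_vector_mult_scaleR mult_ac)
  moreover have "norm (h 0) < \<delta>"
    using \<open>\<delta> > 0\<close> v by (simp add: h_def s_def)
  ultimately have "(\<lambda>t. norm (h t)) \<longlonglongrightarrow> 0" using \<delta> tendsto_norm_zero by blast
  then have "(\<lambda>t. norm (h t) / (s * norm v)) \<longlonglongrightarrow> 0" by (rule tendsto_divide_zero)
  moreover have "(\<lambda>t. norm (h t) / (s * norm v)) = (\<lambda>t. \<bar>c\<bar> ^ t)"
    using s v by (auto simp: h_def abs_mult power_abs)
  ultimately have lim: "(\<lambda>t. \<bar>c\<bar> ^ t) \<longlonglongrightarrow> 0" by simp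
  show ?thesis
  proof (rule ccontr)
    assume "\<not> \<bar>c\<bar> < 1"
    then have "1 \<le> \<bar>c\<bar> ^ t" for t by (simp add: one_le_power)
    then show False using LIMSEQ_le_const[OF lim, of 1] by simp
  qed
qed

text \<open>Every state of a trajectory lies in \<open>V\<close>, so the one-step estimate iterates
  to \<open>r ^ t * norm (h 0)\<close>. This bound gives both Lyapunov stability and
  convergence.\<close>

lemma asymptotically_stable_on_contraction:
  fixes M :: "real ^ 'n ^ 'n"
  assumes r: "0 \<le> r" "r < 1" and le: "\<And>v. v \<in> V \<Longrightarrow> norm (M *v v) \<le> r * norm v"
  shows "asymptotically_stable_on M V"
proof -
  have bound: "norm (h t) \<le> r ^ t * norm (h 0)" if h: "trajectory_in M V h" for h t
  proof (induction t)
    case (Suc t)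
    have "norm (h (Suc t)) \<le> r * norm (h t)" using h le by (simp add: trajectory_in_iff)
    also have "\<dots> \<le> r * (r ^ t * norm (h 0))" using Suc r by (simp add: mult_left_mono)
    finally show ?case by simp
  qed simp
  have "norm (h t) \<le> norm (h 0)" if "trajectory_in M V h" for h t
    using bound[OF that, of t] mult_right_mono[of "r ^ t" 1 "norm (h 0)"] r
    by (simp add: power_le_one)
  \<comment> \<open>Norms never exceed their initial value, so \<delta> = \<epsilon> works.\<close>
  then have "\<exists>\<delta>>0. \<forall>h. trajectory_in M V h \<longrightarrow> norm (h 0) < \<delta> \<longrightarrow> (\<forall>t. norm (h t) < \<epsilon>)"
    if "\<epsilon> > 0" for \<epsilon>
    using that le_less_trans by blast
  moreover have "h \<longlonglongrightarrow> 0" if "trajectory_in M V h" for h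
  proof (rule Lim_null_comparison)
    show "\<forall>\<^sub>F t in sequentially. norm (h t) \<le> r ^ t * norm (h 0)"
      using bound[OF that] by simp
    show "(\<lambda>t. r ^ t * norm (h 0)) \<longlonglongrightarrow> 0"
      using r by (intro tendsto_mult_left_zero LIMSEQ_realpow_zero)
  qed
  \<comment> \<open>Convergence holds from every initial state, so any positive radius will do, here
    1.\<close>
  ultimately show ?thesis
    unfolding asymptotically_stable_on_def using zero_less_one by blast
qed

lemma asymptotically_stable_on_scalar_iff:
  fixes M :: "real ^ 'n ^ 'n"
  assumes "subspace V" and sc: "\<And>v. v \<in> V \<Longrightarrow> M *v v = c *\<^sub>R v" and "w \<in> V" "w \<noteq> 0"
  shows "asymptotically_stable_on M V \<longleftrightarrow> \<bar>c\<bar> < 1"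
proof
  assume "asymptotically_stable_on M V"
  then show "\<bar>c\<bar> < 1" using assms by (blast intro: asymptotically_stable_on_eigenvalue)
next
  assume "\<bar>c\<bar> < 1"
  \<comment> \<open>The contraction factor is \<open>\<bar>c\<bar>\<close>.\<close>
  then show "asymptotically_stable_on M V"
    by (rule asymptotically_stable_on_contraction[rotated]) (simp_all add: sc)
qed

text \<open>Pythagoras before and after the map keeps the factor \<open>r\<close> intact; the
  triangle inequality would only give \<open>r * (norm x + norm y)\<close>.\<close>

lemma norm_add_le_orthogonal:
  fixes x y x' y' :: "'a :: real_inner"
  assumes "orthogonal x y" "orthogonal x' y'" "0 \<le> r"
    and "norm x' \<le> r * norm x" "norm y' \<le> r * norm y"
  shows "norm (x' + y') \<le> r * norm (x + y)"
proof (rule power2_le_imp_le)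
  have "(norm (x' + y'))\<^sup>2 = (norm x')\<^sup>2 + (norm y')\<^sup>2"
    using assms(2) by (rule norm_add_Pythagorean)
  also have "\<dots> \<le> (r * norm x)\<^sup>2 + (r * norm y)\<^sup>2"
    using assms(4,5) by (intro add_mono power_mono) auto
  also have "\<dots> = (r * norm (x + y))\<^sup>2"
    using norm_add_Pythagorean[OF assms(1)] by (simp add: power_mult_distrib distrib_left)
  finally show "(norm (x' + y'))\<^sup>2 \<le> (r * norm (x + y))\<^sup>2" .
qed (use assms(3) in simp)

theorem mainTheorem3:
  fixes M :: "real ^ 'n ^ 'n" and \<alpha> \<beta> :: real
  assumes "M = canonical_coupling \<alpha> \<beta>"
  shows "(zero_sum_subspace :: (real ^ 'n) set) = {x. orthogonal ones x}
    \<and> invariant_subspace M zero_sum_subspace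
    \<and> invariant_subspace M mean_subspace
    \<and> (zero_sum_subspace :: (real ^ 'n) set) \<inter> mean_subspace = {0}
    \<and> {x + y | x y. x \<in> (zero_sum_subspace :: (real ^ 'n) set) \<and> y \<in> mean_subspace} = UNIV
    \<and> (\<forall>v\<in>zero_sum_subspace. M *v v = \<alpha> *\<^sub>R v)
    \<and> (\<forall>v\<in>mean_subspace. M *v v = (\<alpha> + real CARD('n) * \<beta>) *\<^sub>R v)
    \<and> (2 \<le> CARD('n) \<longrightarrow> eigenvalues_on M zero_sum_subspace = {\<alpha>})
    \<and> eigenvalues_on M mean_subspace = {\<alpha> + real CARD('n) * \<beta>}
    \<and> (2 \<le> CARD('n) \<longrightarrow> (asymptotically_stable_on M zero_sum_subspace \<longleftrightarrow> \<bar>\<alpha>\<bar> < 1))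
    \<and> (asymptotically_stable_on M mean_subspace \<longleftrightarrow> \<bar>\<alpha> + real CARD('n) * \<beta>\<bar> < 1)
    \<and> (asymptotically_stable M \<longleftrightarrow>
         (2 \<le> CARD('n) \<longrightarrow> \<bar>\<alpha>\<bar> < 1) \<and> \<bar>\<alpha> + real CARD('n) * \<beta>\<bar> < 1)"
proof -
  let ?Z = "zero_sum_subspace :: (real ^ 'n) set" and ?E = "mean_subspace :: (real ^ 'n) set"
  let ?c = "\<alpha> + real CARD('n) * \<beta>"
  have diff: "M *v v = \<alpha> *\<^sub>R v" if "v \<in> ?Z" for v
    using that by (simp add: assms canonical_coupling_mult_vec zero_sum_subspace_def)
  \<comment> \<open>For \<open>v = k *\<^sub>R ones\<close> the coordinate sum is
    \<open>k * CARD('n)\<close>, which is the origin of the factor \<open>CARD('n)\<close> in front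
    of \<beta>.\<close>
  have mean: "M *v v = ?c *\<^sub>R v" if "v \<in> ?E" for v
    using that by (auto simp: assms canonical_coupling_mult_vec mean_subspace_eq_range
        ones_def vec_eq_iff algebra_simps)
  \<comment> \<open>A common vector is orthogonal to itself.\<close>
  have "?Z \<inter> ?E = {0}"
    using zero_sum_orthogonal_mean subspace_0[OF subspace_zero_sum_subspace]
      subspace_0[OF subspace_mean_subspace] by (fastforce simp: orthogonal_self)
  moreover have "eigenvalues_on M ?Z = {\<alpha>}"
    and "asymptotically_stable_on M ?Z \<longleftrightarrow> \<bar>\<alpha>\<bar> < 1" if "2 \<le> CARD('n)"
    using zero_sum_nonzero_exists[OF that] eigenvalues_on_scalar[of ?Z M \<alpha>]
      asymptotically_stable_on_scalar_iff[of ?Z M \<alpha>] diff subspace_zero_sum_subspace by blast+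
  moreover have "eigenvalues_on M ?E = {?c}"
    using mean ones_in_mean_subspace ones_nonzero by (rule eigenvalues_on_scalar)
  moreover have "asymptotically_stable_on M ?E \<longleftrightarrow> \<bar>?c\<bar> < 1"
    using subspace_mean_subspace mean ones_in_mean_subspace ones_nonzero
    by (rule asymptotically_stable_on_scalar_iff)
  moreover have "asymptotically_stable M \<longleftrightarrow> (2 \<le> CARD('n) \<longrightarrow> \<bar>\<alpha>\<bar> < 1) \<and> \<bar>?c\<bar> < 1"
  proof
    assume st: "asymptotically_stable M"
    show "(2 \<le> CARD('n) \<longrightarrow> \<bar>\<alpha>\<bar> < 1) \<and> \<bar>?c\<bar> < 1"
      \<comment> \<open>An eigenvector of either mode is an eigenvector of \<open>M\<close> in the
        full space.\<close>
      using asymptotically_stable_on_eigenvalue[OF st subspace_UNIV UNIV_I]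
        diff mean zero_sum_nonzero_exists ones_in_mean_subspace ones_nonzero by metis
  next
    assume st: "(2 \<le> CARD('n) \<longrightarrow> \<bar>\<alpha>\<bar> < 1) \<and> \<bar>?c\<bar> < 1"
    \<comment> \<open>For a single variable \<open>\<bar>\<alpha>\<bar>\<close> may be 1 or more, so
      it must stay out of the maximum for \<open>r < 1\<close> to hold. The bound
      \<open>le_diff\<close> survives because \<open>x = 0\<close> then.\<close>
    define r where "r = (if 2 \<le> CARD('n) then max \<bar>\<alpha>\<bar> \<bar>?c\<bar> else \<bar>?c\<bar>)"
    have r: "0 \<le> r" "r < 1" "\<bar>?c\<bar> \<le> r" using st by (auto simp: r_def)
    have le_diff: "norm (\<alpha> *\<^sub>R x) \<le> r * norm x" if "x \<in> ?Z" for x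
    proof (cases "2 \<le> CARD('n)")
      case True
      then show ?thesis by (simp add: r_def mult_right_mono)
    next
      case False
      moreover have "0 < CARD('n)" by simp
      ultimately have "CARD('n) = 1" by linarith
      then show ?thesis using zero_sum_trivial that by force
    qed
    show "asymptotically_stable M"
    proof (rule asymptotically_stable_on_contraction[OF r(1,2)])
      fix v :: "real ^ 'n"
      obtain x y where v: "v = x + y" and x: "x \<in> ?Z" and y: "y \<in> ?E"
        using zero_sum_plus_mean by blast
      have orth: "orthogonal x y" using x y by (rule zero_sum_orthogonal_mean)
      have "norm (\<alpha> *\<^sub>R x + ?c *\<^sub>R y) \<le> r * norm (x + y)"
        using orth r le_diff[OF x]
        by (intro norm_add_le_orthogonal) (auto simp: orthogonal_def mult_right_mono)
      then show "norm (M *v v) \<le> r * norm v"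
        by (simp add: v matrix_vector_right_distrib diff[OF x] mean[OF y])
    qed
  qed
  ultimately show ?thesis
    using zero_sum_subspace_eq_orthogonal zero_sum_plus_mean diff mean
      invariant_subspace_scalar[OF subspace_zero_sum_subspace diff]
      invariant_subspace_scalar[OF subspace_mean_subspace mean] by simp
qed

end
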